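(* Let $C_n$ be the cycle on $n$ vertices, where $n\ge 3$. Then $$b_{\rm R}(C_n)=\begin{cases}2, & \text{if } n\equiv 0,1 \pmod 3;\\ 3, & \text{otherwise.}\end{cases}$$
   Context: Graphs are finite, undirected, without loops or multiple edges; a graph is nonempty if it has at least one edge. A Roman dominating function on $G=(V,E)$ is a function $f:V\to\{0,1,2\}$ such that every vertex $x$ with $f(x)=0$ is adjacent to at least one vertex $y$ with $f(y)=2$. Its weight is $\sum_{u\in V}f(u)$. The Roman domination number $\gamma_{\rm R}(G)$ is the minimum weight of a Roman dominating function on $G$. The Roman bondage number of a nonempty graph $G$ is $b_{\rm R}(G)=\min\{|B|: B\subseteq E(G),\ \gamma_{\rm R}(G-B)>\gamma_{\rm R}(G)\}$, with $b_{\rm R}(G)=\infty$ if no such $B$ exists; here $G-B$ is obtained from $G$ by deleting the edges in $B$ (keeping all vertices). *)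

theory Defs
  imports "HOL-Library.Extended_Nat"
begin

record 'a ugraph =
  verts :: "'a set"
  edges :: "'a set set"

locale simple_graph =
  fixes G :: "'a ugraph"
  assumes finite_verts: "finite (verts G)"
    and edges_verts: "e \<in> edges G \<Longrightarrow> e \<subseteq> verts G"
    and card_edge: "e \<in> edges G \<Longrightarrow> card e = 2"

definition adjacent :: "'a ugraph \<Rightarrow> 'a \<Rightarrow> 'a \<Rightarrow> bool" where
  "adjacent G x y \<longleftrightarrow> {x, y} \<in> edges G"

definition delete_edges :: "'a ugraph \<Rightarrow> 'a set set \<Rightarrow> 'a ugraph" where
  "delete_edges G B = \<lparr>verts = verts G, edges = edges G - B\<rparr>"

text \<open>
  A function on the vertex set is represented by a total function whose values outside
  \<^term>\<open>verts G\<close> are irrelevant; neither the predicate below nor the weight looks at them.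
\<close>

definition roman_dominating :: "'a ugraph \<Rightarrow> ('a \<Rightarrow> nat) \<Rightarrow> bool" where
  "roman_dominating G f \<longleftrightarrow>
     (\<forall>x\<in>verts G. f x \<in> {0, 1, 2}) \<and>
     (\<forall>x\<in>verts G. f x = 0 \<longrightarrow> (\<exists>y\<in>verts G. adjacent G x y \<and> f y = 2))"

definition weight :: "'a ugraph \<Rightarrow> ('a \<Rightarrow> nat) \<Rightarrow> nat" where
  "weight G f = (\<Sum>u\<in>verts G. f u)"

definition roman_domination_number :: "'a ugraph \<Rightarrow> nat" where
  "roman_domination_number G = Inf {weight G f |f. roman_dominating G f}"

text \<open>The infimum is a minimum: the constant function 2 is Roman dominating.\<close>

lemma roman_domination_number_attained:
  "\<exists>f. roman_dominating G f \<and> weight G f = roman_domination_number G"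
proof -
  have "roman_dominating G (\<lambda>_. 2)"
    by (simp add: roman_dominating_def)
  then have "{weight G f |f. roman_dominating G f} \<noteq> {}"
    by blast
  from Inf_nat_def1[OF this] show ?thesis
    unfolding roman_domination_number_def by auto
qed

text \<open>
  The infimum is taken in \<^typ>\<open>enat\<close>, where the infimum of the empty set is \<^term>\<open>\<infinity>\<close>
  and every nonempty set has a least element.
\<close>

definition roman_bondage_number :: "'a ugraph \<Rightarrow> enat" where
  "roman_bondage_number G =
     Inf {enat (card B) |B. B \<subseteq> edges G \<and>
            roman_domination_number (delete_edges G B) > roman_domination_number G}"

text \<open>For \<open>n < 3\<close> this is not a cycle; for \<open>n = 1\<close> it is not even a simple graph.\<close>

definition cycle_graph :: "nat \<Rightarrow> nat ugraph" where
  "cycle_graph n = \<lparr>verts = {0..<n}, edges = {{i, Suc i mod n} |i. i < n}\<rparr>"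

lemma simple_graph_delete_edges:
  assumes "simple_graph G"
  shows "simple_graph (delete_edges G B)"
  using assms by (auto simp: simple_graph_def delete_edges_def)

lemma simple_graph_cycle_graph:
  assumes "n \<ge> 3"
  shows "simple_graph (cycle_graph n)"
proof
  show "finite (verts (cycle_graph n))"
    by (simp add: cycle_graph_def)
next
  fix e assume "e \<in> edges (cycle_graph n)"
  then obtain i where i: "i < n" "e = {i, Suc i mod n}"
    by (auto simp: cycle_graph_def)
  then show "e \<subseteq> verts (cycle_graph n)"
    using assms by (simp add: cycle_graph_def)
  have "Suc i mod n \<noteq> i"
    using i assms by (cases "Suc i = n") auto
  then show "card e = 2"
    using i by simp
qed

lemma edges_cycle_graph_nonempty: "n \<ge> 3 \<Longrightarrow> edges (cycle_graph n) \<noteq> {}"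
  by (auto simp: cycle_graph_def intro: exI[of _ 0])

end

theory Submission
  imports Defs
begin

text \<open>
  Everything rests on the quantity \<open>\<lceil>2 m / 3\<rceil>\<close>, the Roman domination number of a path on \<open>m\<close>
  vertices and of a cycle on \<open>m\<close> vertices. In a graph of maximum degree 2, a vertex with label 2
  takes care of at most three vertices and a vertex with label 1 only of itself, so
  the labels on any union \<open>S\<close> of components sum to at least \<open>\<lceil>2 \<bar>S\<bar> / 3\<rceil>\<close>
  (\<open>two_card_le_sum_labels\<close>). On a path the
  bound is attained by cutting the path into blocks of three and giving label 2 to the middle of
  each block (\<open>path_labelling\<close>).

  Deleting edges therefore raises the Roman domination number only through rounding: the pieces
  must lose more to their separate roundings than the cycle does to its own. With one deleted
  edge there is a single path and nothing is lost. With two deleted edges the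
  lengths \<open>a + b = n\<close> of the pieces can be chosen so that
  \<open>\<lceil>2 a / 3\<rceil> + \<lceil>2 b / 3\<rceil> > \<lceil>2 n / 3\<rceil>\<close> if \<open>n\<close> is 0 modulo 3 (take \<open>a = 1\<close>) or 1 modulo 3
  (take \<open>a = 2\<close>), but never if \<open>n\<close> is 2 modulo 3. In that last case three edges suffice: cut off
  pieces with 1 and 2 vertices.
\<close>

section \<open>Lower bound from the maximum degree\<close>

text \<open>
  The closed neighbourhoods of the vertices labelled 2 in \<open>S\<close>, each with at most \<open>\<Delta> + 1\<close>
  elements, cover \<open>S\<close> up to the vertices labelled 1. The set \<open>S\<close> has to be closed under
  adjacency so that the vertices labelled 2 that dominate it lie in \<open>S\<close> and are counted there.
  The condition \<open>\<Delta> \<ge> 1\<close> makes label 1 at most as efficient as label 2.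
\<close>

lemma two_card_le_sum_labels:
  assumes rdf: "roman_dominating G f"
    and S: "S \<subseteq> verts G" "finite S"
    and closed: "\<And>x y. x \<in> S \<Longrightarrow> adjacent G x y \<Longrightarrow> y \<in> S"
    and degree: "\<And>y. y \<in> S \<Longrightarrow> card {x \<in> S. adjacent G x y} \<le> \<Delta>"
    and "\<Delta> \<ge> 1"
  shows "2 * card S \<le> (\<Delta> + 1) * sum f S"
proof -
  define V1 where "V1 = {x \<in> S. f x = 1}"
  define V2 where "V2 = {x \<in> S. f x = 2}"
  define N where "N y = insert y {x \<in> S. adjacent G x y}" for y
  have fin: "finite V1" "finite V2"
    using S by (auto simp: V1_def V2_def)
  have labels: "f x \<in> {0, 1, 2}" if "x \<in> S" for x
    using rdf S that unfolding roman_dominating_def by blast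
  have "S \<subseteq> V1 \<union> (\<Union>y\<in>V2. N y)"
  proof
    fix x assume x: "x \<in> S"
    show "x \<in> V1 \<union> (\<Union>y\<in>V2. N y)"
    proof (cases "f x = 0")
      case True
      then obtain y where "adjacent G x y" "f y = 2"
        using rdf S x unfolding roman_dominating_def by blast
      then show ?thesis
        using closed[OF x] x by (auto simp: V2_def N_def)
    next
      case False
      then show ?thesis
        using labels[OF x] x by (auto simp: V1_def V2_def N_def)
    qed
  qed
  moreover have "finite (V1 \<union> (\<Union>y\<in>V2. N y))"
    using fin S by (simp add: N_def)
  ultimately have "card S \<le> card (V1 \<union> (\<Union>y\<in>V2. N y))"
    by (simp add: card_mono)
  also have "\<dots> \<le> card V1 + card (\<Union>y\<in>V2. N y)"
    by (rule card_Un_le)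
  also have "card (\<Union>y\<in>V2. N y) \<le> (\<Sum>y\<in>V2. card (N y))"
    using fin(2) by (rule card_UN_le)
  also have "(\<Sum>y\<in>V2. card (N y)) \<le> (\<Sum>y\<in>V2. \<Delta> + 1)"
  proof (rule sum_mono)
    fix y assume "y \<in> V2"
    then have "card {x \<in> S. adjacent G x y} \<le> \<Delta>"
      using degree by (simp add: V2_def)
    then show "card (N y) \<le> \<Delta> + 1"
      unfolding N_def using S by (simp add: card_insert_if)
  qed
  finally have cover: "card S \<le> card V1 + card V2 * (\<Delta> + 1)"
    by simp
  have "sum f S = (\<Sum>x\<in>S. (if x \<in> V1 then 1 else 0) + (if x \<in> V2 then 2 else 0))"
    using labels by (intro sum.cong) (auto simp: V1_def V2_def)
  also have "\<dots> = card V1 + 2 * card V2"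
    using S by (simp add: sum.distrib flip: sum.inter_filter)
      (simp add: V1_def V2_def Collect_conj_eq Int_absorb)
  finally have total: "sum f S = card V1 + 2 * card V2" .
  have "2 * card V1 \<le> (\<Delta> + 1) * card V1"
    using \<open>\<Delta> \<ge> 1\<close> by (intro mult_right_mono) auto
  with cover have "2 * card S \<le> (\<Delta> + 1) * card V1 + 2 * (card V2 * (\<Delta> + 1))"
    by linarith
  then show ?thesis
    unfolding total by (simp only: algebra_simps)
qed

section \<open>Upper bound from a partition into paths\<close>

text \<open>
  The path is labelled in blocks of three, \<open>0, 2, 0\<close> on each block; a remaining single vertex gets
  label 1 and a remaining pair the labels \<open>0, 2\<close>. Dominating vertices are found within the path
  itself, so labellings of disjoint paths can be put together.
\<close>

lemma path_labelling:
  assumes "symp R" "successively R xs" "distinct xs"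
  shows "\<exists>f :: 'a \<Rightarrow> nat.
           (\<forall>x\<in>set xs. f x \<in> {0, 1, 2} \<and> (f x = 0 \<longrightarrow> (\<exists>y\<in>set xs. R x y \<and> f y = 2))) \<and>
           sum f (set xs) \<le> (2 * length xs + 2) div 3"
  using assms(2,3)
proof (induction "length xs" arbitrary: xs rule: less_induct)
  case less
  consider "xs = []" | x where "xs = [x]" | x y where "xs = [x, y]"
    | x y z zs where "xs = x # y # z # zs"
    by (metis list.exhaust)
  then show ?case
  proof cases
    case 1
    then show ?thesis by simp
  next
    case 2
    then show ?thesis
      by (intro exI[of _ "\<lambda>_. 1"]) simp
  next
    case 3
    then show ?thesis
      using less.prems by (intro exI[of _ "\<lambda>u. if u = y then 2 else 0"]) auto
  next
    case 4
    have "successively R zs" "distinct zs" "length zs < length xs"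
      using less.prems 4 by (auto simp: successively_Cons)
    then obtain f where f: "\<forall>u\<in>set zs. f u \<in> {0, 1, 2} \<and>
          (f u = 0 \<longrightarrow> (\<exists>v\<in>set zs. R u v \<and> f v = 2))"
        and wt: "sum f (set zs) \<le> (2 * length zs + 2) div 3"
      using less.hyps by blast
    define g where "g = f(x := 0, y := (2::nat), z := 0)"
    have new: "x \<notin> set zs" "y \<notin> set zs" "z \<notin> set zs" "x \<noteq> y" "x \<noteq> z" "y \<noteq> z"
      using less.prems 4 by auto
    have R: "R x y" "R z y"
      using less.prems 4 \<open>symp R\<close> by (auto dest: sympD)
    have g_old: "g u = f u" if "u \<in> set zs" for u
      using that new by (auto simp: g_def)
    have "sum g (set xs) = 2 + sum g (set zs)"
      using new 4 by (simp add: g_def)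
    also have "sum g (set zs) = sum f (set zs)"
      using g_old by (rule sum.cong[OF refl])
    finally have "sum g (set xs) \<le> (2 * length xs + 2) div 3"
      using wt 4 by simp
    moreover have "g u \<in> {0, 1, 2} \<and> (g u = 0 \<longrightarrow> (\<exists>v\<in>set xs. R u v \<and> g v = 2))"
      if u: "u \<in> set xs" for u
    proof (cases "u \<in> set zs")
      case True
      then show ?thesis
        using f g_old 4 by (metis list.set_intros(2))
    next
      case False
      then have "u \<in> {x, y, z}"
        using u 4 by auto
      moreover have "g y = 2" "g x = 0" "g z = 0"
        using new by (auto simp: g_def)
      moreover have "y \<in> set xs"
        using 4 by simp
      ultimately show ?thesis
        using R by auto
    qed
    ultimately show ?thesis
      by blast
  qed
qed

lemma roman_domination_number_le_weight:
  "roman_dominating G f \<Longrightarrow> roman_domination_number G \<le> weight G f"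
  unfolding roman_domination_number_def by (intro cInf_lower) auto

lemma roman_domination_number_le_two_paths:
  assumes verts: "verts G = set xs \<union> set ys"
    and distinct: "distinct (xs @ ys)"
    and paths: "successively (adjacent G) xs" "successively (adjacent G) ys"
  shows "roman_domination_number G \<le> (2 * length xs + 2) div 3 + (2 * length ys + 2) div 3"
proof -
  have sym: "symp (adjacent G)"
    by (auto simp: symp_def adjacent_def insert_commute)
  obtain f where f: "\<forall>x\<in>set xs. f x \<in> {0, 1, 2} \<and>
        (f x = 0 \<longrightarrow> (\<exists>y\<in>set xs. adjacent G x y \<and> f y = 2))"
      and f_sum: "sum f (set xs) \<le> (2 * length xs + 2) div 3"
    using path_labelling[OF sym paths(1)] distinct by auto
  obtain g where g: "\<forall>x\<in>set ys. g x \<in> {0, 1, 2} \<and>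
        (g x = 0 \<longrightarrow> (\<exists>y\<in>set ys. adjacent G x y \<and> g y = 2))"
      and g_sum: "sum g (set ys) \<le> (2 * length ys + 2) div 3"
    using path_labelling[OF sym paths(2)] distinct by auto
  define h where "h x = (if x \<in> set xs then f x else g x)" for x
  have h_xs: "h x = f x" if "x \<in> set xs" for x
    using that by (simp add: h_def)
  have h_ys: "h x = g x" if "x \<in> set ys" for x
    using that distinct by (auto simp: h_def)
  have "roman_dominating G h"
    unfolding roman_dominating_def verts
    using f g h_xs h_ys by (metis UnCI UnE)
  then have "roman_domination_number G \<le> weight G h"
    by (rule roman_domination_number_le_weight)
  also have "weight G h = sum h (set xs) + sum h (set ys)"
    unfolding weight_def verts using distinct by (intro sum.union_disjoint) auto
  also have "\<dots> = sum f (set xs) + sum g (set ys)"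
    using h_xs h_ys by simp
  finally show ?thesis
    using f_sum g_sum by linarith
qed

section \<open>Cycles with deleted edges\<close>

abbreviation cycle_edge :: "nat \<Rightarrow> nat \<Rightarrow> nat set" where
  "cycle_edge n i \<equiv> {i, Suc i mod n}"

lemma adjacent_cycle_minus:
  "adjacent (delete_edges (cycle_graph n) B) x y \<longleftrightarrow>
     (\<exists>i<n. {x, y} = cycle_edge n i \<and> cycle_edge n i \<notin> B)"
  by (auto simp: adjacent_def delete_edges_def cycle_graph_def)

lemma cycle_edge_inj:
  assumes "n \<ge> 3" "i < n" "j < n" "cycle_edge n i = cycle_edge n j"
  shows "i = j"
  using assms by (cases "Suc i = n"; cases "Suc j = n") (auto simp: doubleton_eq_iff)

text \<open>
  Removing the edges after \<open>i\<close> and after \<open>j\<close> splits the cycle into the path \<open>i + 1, \<dots>, j\<close> and the path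
  \<open>j + 1, \<dots>, n - 1, 0, \<dots>, i\<close>. For \<open>i = j\<close> the first path is empty, which covers the deletion of a
  single edge.
\<close>

lemma roman_domination_number_cycle_minus_two_le:
  assumes n: "n \<ge> 3" and ij: "i \<le> j" "j < n" and B: "B \<subseteq> {cycle_edge n i, cycle_edge n j}"
  shows "roman_domination_number (delete_edges (cycle_graph n) B)
           \<le> (2 * (j - i) + 2) div 3 + (2 * (n - (j - i)) + 2) div 3"
proof -
  let ?G = "delete_edges (cycle_graph n) B"
  have step: "adjacent ?G k (Suc k mod n)" if "k < n" "k \<noteq> i" "k \<noteq> j" for k
  proof -
    have "cycle_edge n k \<notin> B"
      using B cycle_edge_inj[OF n that(1), of i] cycle_edge_inj[OF n that(1), of j] ij that by auto
    then show ?thesis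
      using that unfolding adjacent_cycle_minus by blast
  qed
  have segment: "successively (adjacent ?G) [a..<b]"
    if "b \<le> n" "\<And>k. a \<le> k \<Longrightarrow> Suc k < b \<Longrightarrow> k \<noteq> i \<and> k \<noteq> j" for a b
    unfolding successively_conv_nth
  proof (intro allI impI)
    fix k assume k: "Suc k < length [a..<b]"
    then have "adjacent ?G (a + k) (Suc (a + k) mod n)"
      using that by (intro step) auto
    then show "adjacent ?G ([a..<b] ! k) ([a..<b] ! Suc k)"
      using k that(1) by simp
  qed
  have arc1: "successively (adjacent ?G) [Suc i..<Suc j]"
    using ij by (intro segment) auto
  have "successively (adjacent ?G) [Suc j..<n]" "successively (adjacent ?G) [0..<Suc i]"
    using ij by - (rule segment; simp)+
  moreover have "adjacent ?G (n - 1) 0" if "Suc j < n"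
    using step[of "n - 1"] that ij n by simp
  ultimately have arc2: "successively (adjacent ?G) ([Suc j..<n] @ [0..<Suc i])"
    by (cases "Suc j < n") (simp_all add: successively_append_iff del: upt_Suc)
  have "verts ?G = set [Suc i..<Suc j] \<union> set ([Suc j..<n] @ [0..<Suc i])"
    using ij by (auto simp: delete_edges_def cycle_graph_def)
  moreover have "distinct ([Suc i..<Suc j] @ ([Suc j..<n] @ [0..<Suc i]))"
    using ij by auto
  ultimately have "roman_domination_number ?G \<le> (2 * length [Suc i..<Suc j] + 2) div 3
      + (2 * length ([Suc j..<n] @ [0..<Suc i]) + 2) div 3"
    using arc1 arc2 by (rule roman_domination_number_le_two_paths)
  moreover have "length [Suc i..<Suc j] = j - i"
    "length ([Suc j..<n] @ [0..<Suc i]) = n - (j - i)"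
    using ij by auto
  ultimately show ?thesis
    by metis
qed

text \<open>
  The deleted edges isolate the vertices \<open>a, \<dots>, b - 1\<close> from the others. The edge between \<open>n - 1\<close> and
  0 is deleted throughout, so that pieces do not wrap around.
\<close>

lemma piece_of_cycle_bound:
  assumes rdf: "roman_dominating (delete_edges (cycle_graph n) B) f"
    and n: "n \<ge> 3" and ab: "a < b" "b \<le> n"
    and cuts: "cycle_edge n (n - 1) \<in> B" "a = 0 \<or> cycle_edge n (a - 1) \<in> B"
      "cycle_edge n (b - 1) \<in> B"
  shows "2 * (b - a) \<le> 3 * sum f {a..<b}"
proof -
  let ?G = "delete_edges (cycle_graph n) B"
  have step: "\<exists>i. Suc i < n \<and> cycle_edge n i \<notin> B \<and> {x, y} = {i, Suc i}"
    if adj: "adjacent ?G x y" for x y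
  proof -
    obtain i where i: "i < n" "{x, y} = cycle_edge n i" "cycle_edge n i \<notin> B"
      using adj unfolding adjacent_cycle_minus by blast
    moreover have "i \<noteq> n - 1"
      using i cuts by blast
    ultimately show ?thesis
      by (intro exI[of _ i]) auto
  qed
  have "2 * card {a..<b} \<le> (2 + 1) * sum f {a..<b}"
  proof (rule two_card_le_sum_labels[OF rdf])
    show "{a..<b} \<subseteq> verts ?G"
      using ab by (auto simp: delete_edges_def cycle_graph_def)
  next
    fix x y assume x: "x \<in> {a..<b}" and adj: "adjacent ?G x y"
    obtain i where i: "Suc i < n" "cycle_edge n i \<notin> B" "{x, y} = {i, Suc i}"
      using step[OF adj] by blast
    have "i \<noteq> b - 1" "a = 0 \<or> i \<noteq> a - 1"
      using i(2) cuts by blast+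
    with x i(3) show "y \<in> {a..<b}"
      by (auto simp: doubleton_eq_iff)
  next
    fix y
    have "{x \<in> {a..<b}. adjacent ?G x y} \<subseteq> {y - 1, Suc y}"
      using step by (fastforce simp: doubleton_eq_iff)
    then have "card {x \<in> {a..<b}. adjacent ?G x y} \<le> card {y - 1, Suc y}"
      by (intro card_mono) auto
    also have "\<dots> \<le> 2"
      by (simp add: card_insert_if)
    finally show "card {x \<in> {a..<b}. adjacent ?G x y} \<le> 2" .
  qed auto
  then show ?thesis
    by simp
qed

lemma weight_cycle_minus:
  "weight (delete_edges (cycle_graph n) B) f = sum f {0..<n}"
  by (simp add: weight_def delete_edges_def cycle_graph_def)

lemma roman_domination_number_cycle:
  assumes n: "n \<ge> 3"
  shows "roman_domination_number (cycle_graph n) = (2 * n + 2) div 3"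
proof (rule antisym)
  show "roman_domination_number (cycle_graph n) \<le> (2 * n + 2) div 3"
    using roman_domination_number_cycle_minus_two_le[OF n, of 0 0 "{}"] n
    by (simp add: delete_edges_def cycle_graph_def)
next
  obtain f where f: "roman_dominating (cycle_graph n) f"
      "weight (cycle_graph n) f = roman_domination_number (cycle_graph n)"
    using roman_domination_number_attained by blast
  have "2 * card {0..<n} \<le> (2 + 1) * sum f {0..<n}"
  proof (rule two_card_le_sum_labels[OF f(1)])
    fix x y assume "x \<in> {0..<n}" "adjacent (cycle_graph n) x y"
    then show "y \<in> {0..<n}"
      using simple_graph.edges_verts[OF simple_graph_cycle_graph[OF n], of "{x, y}"]
      by (simp add: adjacent_def) (simp add: cycle_graph_def)
  next
    fix y
    have "{x \<in> {0..<n}. adjacent (cycle_graph n) x y}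
            \<subseteq> {Suc y mod n, if y = 0 then n - 1 else y - 1}"
    proof
      fix x assume "x \<in> {x \<in> {0..<n}. adjacent (cycle_graph n) x y}"
      then obtain i where "i < n" "{x, y} = cycle_edge n i"
        by (auto simp: adjacent_def cycle_graph_def)
      then show "x \<in> {Suc y mod n, if y = 0 then n - 1 else y - 1}"
        by (cases "Suc i = n") (auto simp: doubleton_eq_iff)
    qed
    then have "card {x \<in> {0..<n}. adjacent (cycle_graph n) x y}
                 \<le> card {Suc y mod n, if y = 0 then n - 1 else y - 1}"
      by (intro card_mono) auto
    also have "\<dots> \<le> 2"
      by (simp add: card_insert_if)
    finally show "card {x \<in> {0..<n}. adjacent (cycle_graph n) x y} \<le> 2" .
  qed (auto simp: cycle_graph_def)
  moreover have "weight (cycle_graph n) f = sum f {0..<n}"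
    by (simp add: weight_def cycle_graph_def)
  ultimately show "(2 * n + 2) div 3 \<le> roman_domination_number (cycle_graph n)"
    using f(2) by simp
qed

section \<open>The Roman bondage number\<close>

lemma roman_bondage_number_leI:
  assumes "B \<subseteq> edges G"
    and "roman_domination_number G < roman_domination_number (delete_edges G B)"
    and "card B \<le> k"
  shows "roman_bondage_number G \<le> enat k"
proof -
  have "roman_bondage_number G \<le> enat (card B)"
    unfolding roman_bondage_number_def using assms by (intro Inf_lower) auto
  also have "\<dots> \<le> enat k"
    using assms by simp
  finally show ?thesis .
qed

lemma roman_bondage_number_geI:
  assumes "\<And>B. B \<subseteq> edges G \<Longrightarrow> card B < k \<Longrightarrow>
             roman_domination_number (delete_edges G B) \<le> roman_domination_number G"
  shows "enat k \<le> roman_bondage_number G"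
  unfolding roman_bondage_number_def
proof (rule Inf_greatest)
  fix m
  assume "m \<in> {enat (card B) |B. B \<subseteq> edges G \<and>
            roman_domination_number (delete_edges G B) > roman_domination_number G}"
  then show "enat k \<le> m"
    using assms by (auto simp: not_less[symmetric])
qed

lemma at_most_two_cycle_edges:
  assumes "n \<ge> 3" "B \<subseteq> edges (cycle_graph n)" "card B < 3"
  obtains i j where "i \<le> j" "j < n" "B \<subseteq> {cycle_edge n i, cycle_edge n j}"
    "card B < 2 \<Longrightarrow> i = j"
proof -
  let ?e = "cycle_edge n"
  have edges: "edges (cycle_graph n) = ?e ` {..<n}"
    by (auto simp: cycle_graph_def)
  have "B \<subseteq> ?e ` {..<n}"
    using assms by (simp add: edges)
  then obtain I where I: "I \<subseteq> {..<n}" "inj_on ?e I" "B = ?e ` I"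
    unfolding subset_image_inj by blast
  have "card I < 3" "finite I" and card: "card B = card I"
    using I assms by (auto simp: card_image finite_subset)
  then consider "card I = 0" | "card I = 1" | "card I = 2"
    by linarith
  then show ?thesis
  proof cases
    case 1
    then show ?thesis
      using that[of 0 0] \<open>finite I\<close> I assms by auto
  next
    case 2
    then obtain i where "I = {i}"
      by (auto simp: card_1_singleton_iff)
    then show ?thesis
      using that[of i i] I by auto
  next
    case 3
    then obtain i j where "I = {i, j}" "i \<noteq> j"
      by (auto simp: card_2_iff)
    then show ?thesis
      using that[of "min i j" "max i j"] I 3 card by (auto simp: min_def max_def)
  qed
qed

lemma roman_bondage_number_cycle_ge_2:
  assumes n: "n \<ge> 3"
  shows "enat 2 \<le> roman_bondage_number (cycle_graph n)"
proof (rule roman_bondage_number_geI)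
  fix B assume B: "B \<subseteq> edges (cycle_graph n)" "card B < 2"
  then have "card B < 3"
    by simp
  with n B(1) obtain i j where "j < n" "B \<subseteq> {cycle_edge n i, cycle_edge n j}"
      "card B < 2 \<Longrightarrow> i = j"
    by (rule at_most_two_cycle_edges) blast
  with B(2) have "i < n" "B \<subseteq> {cycle_edge n i, cycle_edge n i}"
    by auto
  then show "roman_domination_number (delete_edges (cycle_graph n) B)
               \<le> roman_domination_number (cycle_graph n)"
    using roman_domination_number_cycle_minus_two_le[OF n, of i i B]
      roman_domination_number_cycle[OF n] by simp
qed

text \<open>
  If \<open>n\<close> is 2 modulo 3, the lengths of the two pieces are congruent to 0 and 2 or both to 1
  modulo 3; in either case the two roundings add up to exactly the rounding for the cycle.
\<close>

lemma roman_bondage_number_cycle_ge_3: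
  assumes n: "n \<ge> 3" and mod: "n mod 3 = 2"
  shows "enat 3 \<le> roman_bondage_number (cycle_graph n)"
proof (rule roman_bondage_number_geI)
  fix B assume B: "B \<subseteq> edges (cycle_graph n)" "card B < 3"
  with n obtain i j where ij: "i \<le> j" "j < n" "B \<subseteq> {cycle_edge n i, cycle_edge n j}"
    by (rule at_most_two_cycle_edges) blast
  have "(2 * d + 2) div 3 + (2 * (n - d) + 2) div 3 \<le> (2 * n + 2) div 3" if "d \<le> n" for d
  proof -
    define q r where "q = d div 3" and "r = d mod 3"
    have d: "d = 3 * q + r" and r: "r < 3"
      by (simp_all add: q_def r_def)
    have "q \<le> n div 3"
      unfolding q_def using that by (rule div_le_mono)
    then obtain p where "n div 3 = q + p"
      by (auto simp: le_iff_add)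
    then have "n = 3 * (q + p) + 2"
      using mod div_mult_mod_eq[of n 3] by simp
    then have n_eq: "n = 3 * (q + p) + 2" and rest: "n - d = 3 * p + (2 - r)"
      using r by (auto simp: d)
    \<comment> \<open>A remainder \<open>u\<close> modulo 3 costs exactly \<open>u\<close>, and the remainders \<open>r\<close> and \<open>2 - r\<close> of the
        two pieces add up to the remainder of \<open>n\<close>.\<close>
    have cost: "(2 * (3 * t + u) + 2) div 3 = 2 * t + u" if "u < 3" for t u :: nat
      using that by (intro div_nat_eqI) auto
    have "(2 * d + 2) div 3 = 2 * q + r"
      unfolding d by (rule cost[OF r])
    moreover have "(2 * (n - d) + 2) div 3 = 2 * p + (2 - r)"
      unfolding rest by (rule cost) simp
    moreover have "(2 * n + 2) div 3 = 2 * (q + p) + 2"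
      unfolding n_eq by (rule cost) simp
    ultimately show ?thesis
      using r by simp
  qed
  moreover have "j - i \<le> n"
    using ij by simp
  ultimately show "roman_domination_number (delete_edges (cycle_graph n) B)
               \<le> roman_domination_number (cycle_graph n)"
    unfolding roman_domination_number_cycle[OF n]
    using roman_domination_number_cycle_minus_two_le[OF n ij] by (blast intro: order_trans)
qed

text \<open>
  One vertex is cut off if \<open>n\<close> is 0 modulo 3, two if \<open>n\<close> is 1 modulo 3. The rest then has length
  \<open>m\<close> congruent to 2 modulo 3, the residue for which the bound \<open>2 m / 3\<close> gains most, namely \<open>2 / 3\<close>,
  by rounding up; the short piece gains another \<open>1 / 3\<close> or \<open>2 / 3\<close>, and the total exceeds what the
  cycle gains.
\<close>

lemma roman_bondage_number_cycle_le_2: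
  assumes n: "n \<ge> 3" and mod: "n mod 3 = 0 \<or> n mod 3 = 1"
  shows "roman_bondage_number (cycle_graph n) \<le> enat 2"
proof -
  define s where "s = Suc (n mod 3)"
  have s: "s = 1 \<or> s = 2" "s < n"
    using n mod by (auto simp: s_def)
  define B where "B = {cycle_edge n (n - 1), cycle_edge n (s - 1)}"
  let ?G = "delete_edges (cycle_graph n) B"
  obtain f where f: "roman_dominating ?G f" "weight ?G f = roman_domination_number ?G"
    using roman_domination_number_attained by blast
  have pieces: "2 * (s - 0) \<le> 3 * sum f {0..<s}" "2 * (n - s) \<le> 3 * sum f {s..<n}"
    using s by - (rule piece_of_cycle_bound[OF f(1) n]; auto simp: B_def)+
  have n_eq: "n + 1 = 3 * (n div 3) + s"
    by (simp add: s_def)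
  moreover have "s \<le> sum f {0..<s}"
    using pieces(1) s(1) by linarith
  moreover have "2 * (n div 3) \<le> sum f {s..<n}"
    using pieces(2) n_eq s(2) by linarith
  moreover have "sum f {0..<n} = sum f {0..<s} + sum f {s..<n}"
    using s by (simp add: sum.atLeastLessThan_concat)
  ultimately have "2 * n + 2 < 3 * sum f {0..<n}"
    using s(1) by linarith
  then have "(2 * n + 2) div 3 < sum f {0..<n}"
    by (simp add: div_less_iff_less_mult)
  then have "roman_domination_number (cycle_graph n) < roman_domination_number ?G"
    using f(2) roman_domination_number_cycle[OF n] by (simp add: weight_cycle_minus)
  moreover have "B \<subseteq> edges (cycle_graph n)"
    using s n by (auto simp: B_def cycle_graph_def)
  moreover have "card B \<le> 2"
    by (simp add: B_def card_insert_if)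
  ultimately show ?thesis
    by (intro roman_bondage_number_leI)
qed

text \<open>
  The cycle already gains \<open>2 / 3\<close> by rounding here. Pieces with 1, 2 and \<open>n - 3\<close> vertices
  gain \<open>1 / 3\<close>, \<open>2 / 3\<close> and \<open>2 / 3\<close>, that is 1 more in total.
\<close>

lemma roman_bondage_number_cycle_le_3:
  assumes n: "n \<ge> 3" and mod: "n mod 3 = 2"
  shows "roman_bondage_number (cycle_graph n) \<le> enat 3"
proof -
  have "3 < n"
    using n mod by (cases "n = 3") auto
  define B where "B = {cycle_edge n (n - 1), cycle_edge n 0, cycle_edge n 2}"
  let ?G = "delete_edges (cycle_graph n) B"
  obtain f where f: "roman_dominating ?G f" "weight ?G f = roman_domination_number ?G"
    using roman_domination_number_attained by blast
  have "2 * (1 - 0) \<le> 3 * sum f {0..<1}" "2 * (3 - 1) \<le> 3 * sum f {1..<3}"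
    "2 * (n - 3) \<le> 3 * sum f {3..<n}"
    using \<open>3 < n\<close> by - (rule piece_of_cycle_bound[OF f(1) n]; simp add: B_def)+
  moreover have "sum f {0..<n} = sum f {0..<1} + sum f {1..<3} + sum f {3..<n}"
    using n sum.atLeastLessThan_concat[of 0 1 3 f] sum.atLeastLessThan_concat[of 0 3 n f] by simp
  moreover have "n = 3 * (n div 3) + 2"
    using mod div_mult_mod_eq[of n 3] by simp
  ultimately have "2 * n + 2 < 3 * sum f {0..<n}"
    using \<open>3 < n\<close> by presburger
  then have "(2 * n + 2) div 3 < sum f {0..<n}"
    by (simp add: div_less_iff_less_mult)
  then have "roman_domination_number (cycle_graph n) < roman_domination_number ?G"
    using f(2) roman_domination_number_cycle[OF n] by (simp add: weight_cycle_minus)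
  moreover have "B \<subseteq> edges (cycle_graph n)"
    using n \<open>3 < n\<close> by (auto simp: B_def cycle_graph_def)
  moreover have "card B \<le> 3"
    by (simp add: B_def card_insert_if)
  ultimately show ?thesis
    by (intro roman_bondage_number_leI)
qed

theorem corollary3p2:
  fixes n :: nat
  assumes "n \<ge> 3"
  shows "roman_bondage_number (cycle_graph n) =
           (if n mod 3 = 0 \<or> n mod 3 = 1 then 2 else 3)"
proof (cases "n mod 3 = 0 \<or> n mod 3 = 1")
  case True
  have "roman_bondage_number (cycle_graph n) = enat 2"
    using roman_bondage_number_cycle_le_2[OF assms True] roman_bondage_number_cycle_ge_2[OF assms]
    by (rule antisym)
  then show ?thesis
    using True by (simp add: numeral_eq_enat)
next
  case False
  then have "n mod 3 = 2"
    by linarith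
  then have "roman_bondage_number (cycle_graph n) = enat 3"
    using roman_bondage_number_cycle_le_3 roman_bondage_number_cycle_ge_3 assms
    by (intro antisym) auto
  then show ?thesis
    using False by (simp add: numeral_eq_enat)
qed

end
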